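(* Let $s,t$ be positive integers. Define $(Q_n)_{n\ge0}$ as follows: for each $n\ge 0$, if $n=tQ_m+sm$ for some $m<n$ such that the value $Q_m$ occurs exactly once among $Q_0,\dots,Q_{n-1}$, then $Q_n=Q_m$; otherwise $Q_n=\operatorname{mex}\{Q_m:0\le m<n\}$. For each $n$ let $A'_n$ be the smallest $k$ with $Q_k=n$ and $B'_n$ the largest $k$ with $Q_k=n$. Define also $(A_n)_{n\ge0}$, $(B_n)_{n\ge0}$ by $A_n=\operatorname{mex}\{A_i,B_i:0\le i<n\}$ and $B_n=sA_n+tn$. Then $A'_n=A_n$ and $B'_n=B_n$ for all positive integers $n$.
   Context: For a finite set $S$ of nonnegative integers, $\operatorname{mex} S$ is the least nonnegative integer not in $S$ (so $\operatorname{mex}\emptyset=0$). *)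

theory Defs
  imports Main
begin

definition mex :: "nat set \<Rightarrow> nat" where
  "mex S = (LEAST k. k \<notin> S)"

context
  notes conj_cong[fundef_cong]
begin

text \<open>When the case condition holds, the index \<open>m\<close> is unique for positive \<open>s\<close> and \<open>t\<close>, so
  the definite description denotes \<open>Q\<^sub>m\<close>; see \<open>Q_copy\<close> below.\<close>

function Q :: "nat \<Rightarrow> nat \<Rightarrow> nat \<Rightarrow> nat" where
  "Q s t n =
     (if \<exists>m. m < n \<and> n = t * Q s t m + s * m \<and> card {j. j < n \<and> Q s t j = Q s t m} = 1
      then THE q. \<exists>m. m < n \<and> n = t * Q s t m + s * m \<and>
             card {j. j < n \<and> Q s t j = Q s t m} = 1 \<and> q = Q s t m
      else mex (Q s t ` {..<n}))"
  by pat_completeness auto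
termination by (relation "measure (\<lambda>(s, t, n). n)") auto

end

declare Q.simps[simp del]

text \<open>\<open>LEAST\<close> and \<open>GREATEST\<close> are meaningful here: every value is attained and only finitely
  often; see \<open>Q_attained\<close> and \<open>finite_Q_fibre\<close> below.\<close>

definition A' :: "nat \<Rightarrow> nat \<Rightarrow> nat \<Rightarrow> nat" where
  "A' s t n = (LEAST k. Q s t k = n)"

definition B' :: "nat \<Rightarrow> nat \<Rightarrow> nat \<Rightarrow> nat" where
  "B' s t n = (GREATEST k. Q s t k = n)"

function A :: "nat \<Rightarrow> nat \<Rightarrow> nat \<Rightarrow> nat" and B :: "nat \<Rightarrow> nat \<Rightarrow> nat \<Rightarrow> nat" where
  "A s t n = mex (\<Union>i\<in>{..<n}. {A s t i, B s t i})"
| "B s t n = s * A s t n + t * n"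
  by pat_completeness auto
termination
  by (relation "measure (\<lambda>x. case x of Inl (s, t, n) \<Rightarrow> 2 * n | Inr (s, t, n) \<Rightarrow> 2 * n + 1)") auto

declare A.simps[simp del] B.simps[simp del]

definition copies :: "nat \<Rightarrow> nat \<Rightarrow> nat \<Rightarrow> nat \<Rightarrow> bool" where
  "copies s t n m \<longleftrightarrow>
     m < n \<and> n = t * Q s t m + s * m \<and> card {j. j < n \<and> Q s t j = Q s t m} = 1"

lemma Q_unfold:
  "Q s t n = (if \<exists>m. copies s t n m then THE q. \<exists>m. copies s t n m \<and> q = Q s t m
              else mex (Q s t ` {..<n}))"
  unfolding copies_def by (subst Q.simps) (simp only: conj_assoc)

lemma mex_lessThan: "mex {..<v} = v"
  unfolding mex_def by (rule Least_equality) auto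

lemma copies_firstD:
  assumes "copies s t n m" "j < m"
  shows "Q s t j \<noteq> Q s t m"
proof
  assume eq: "Q s t j = Q s t m"
  from assms(1) obtain x where x: "{j. j < n \<and> Q s t j = Q s t m} = {x}" and "m < n"
    unfolding copies_def by (auto simp: card_1_singleton_iff)
  then have "m \<in> {x}" "j \<in> {x}" using eq assms(2) by (auto simp flip: x)
  then show False using assms(2) by simp
qed

lemma copies_unique_aux:
  assumes "s > 0" "\<And>k. k \<le> n \<Longrightarrow> \<exists>v. Q s t ` {..<k} = {..<v}"
    and "copies s t n m" "copies s t n m'" "m < m'"
  shows False
proof -
  have "m' < n" using assms(4) by (simp add: copies_def)
  obtain v where v: "Q s t ` {..<m'} = {..<v}" using assms(2)[of m'] \<open>m' < n\<close> by auto
  have "Q s t m < v" using v assms(5) by auto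
  moreover have "Q s t m' \<notin> Q s t ` {..<m'}" using copies_firstD[OF assms(4)] by force
  ultimately have "Q s t m \<le> Q s t m'" using v by auto
  then have "t * Q s t m + s * m < t * Q s t m' + s * m'"
    using assms(1,5) by (intro add_le_less_mono) auto
  then show False using assms(3,4) by (simp add: copies_def)
qed

lemma Q_copy_aux:
  assumes "s > 0" "\<And>k. k \<le> n \<Longrightarrow> \<exists>v. Q s t ` {..<k} = {..<v}" "copies s t n m"
  shows "Q s t n = Q s t m"
proof -
  have "m' = m" if "copies s t n m'" for m'
    using copies_unique_aux[OF assms(1,2)] that assms(3) by (meson linorder_neqE_nat)
  then have "(THE q. \<exists>m. copies s t n m \<and> q = Q s t m) = Q s t m"
    using assms(3) by (intro the_equality) blast+
  moreover have "\<exists>m. copies s t n m" using assms(3) by blast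
  ultimately show ?thesis by (simp only: Q_unfold[of s t n] if_True simp_thms)
qed

lemma Q_image_initial:
  assumes "s > 0"
  shows "\<exists>v. Q s t ` {..<n} = {..<v}"
proof (induction n rule: less_induct)
  case (less n)
  show ?case
  proof (cases n)
    case 0
    then show ?thesis by (intro exI[of _ 0]) simp
  next
    case (Suc n')
    then obtain v where v: "Q s t ` {..<n'} = {..<v}" using less.IH[of n'] by auto
    show ?thesis
    proof (cases "\<exists>m. copies s t n' m")
      case True
      then obtain m where m: "copies s t n' m" by blast
      have "Q s t n' = Q s t m"
        using less.IH Suc by (intro Q_copy_aux assms m) auto
      moreover have "m < n'" using m by (simp add: copies_def)
      ultimately have "Q s t n' \<in> Q s t ` {..<n'}" by auto
      then have "Q s t ` {..<n} = {..<v}" using v Suc by (auto simp: lessThan_Suc)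
      then show ?thesis by blast
    next
      case False
      then have "Q s t n' = v" using v mex_lessThan[of v] by (metis Q_unfold)
      then have "Q s t ` {..<n} = {..<Suc v}" using v Suc by (simp add: lessThan_Suc)
      then show ?thesis by blast
    qed
  qed
qed

lemma copies_unique:
  assumes "s > 0" "copies s t n m" "copies s t n m'"
  shows "m = m'"
  using copies_unique_aux[OF assms(1) Q_image_initial[OF assms(1)]] assms(2,3)
  by (meson linorder_neqE_nat)

lemma Q_copy:
  assumes "s > 0" "copies s t n m"
  shows "Q s t n = Q s t m"
  using Q_copy_aux[OF assms(1) Q_image_initial[OF assms(1)] assms(2)] .

lemma Q_mex:
  assumes "\<nexists>m. copies s t n m"
  shows "Q s t n = mex (Q s t ` {..<n})"
  using assms by (subst Q_unfold) auto

lemma card_Q_fibre_le_2: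
  assumes "s > 0"
  shows "card {j. j < n \<and> Q s t j = q} \<le> 2"
proof (induction n)
  case 0
  then show ?case by simp
next
  case (Suc n)
  have split: "{j. j < Suc n \<and> Q s t j = q} =
      (if Q s t n = q then insert n {j. j < n \<and> Q s t j = q} else {j. j < n \<and> Q s t j = q})"
    by (auto simp: less_Suc_eq)
  show ?case
  proof (cases "Q s t n = q")
    case True
    have "card {j. j < n \<and> Q s t j = q} \<le> 1"
    proof (cases "\<exists>m. copies s t n m")
      case t: True
      then obtain m where m: "copies s t n m" by blast
      have "Q s t m = q" using Q_copy[OF assms m] True by simp
      then have "card {j. j < n \<and> Q s t j = q} = 1" using m unfolding copies_def by blast
      then show ?thesis by (rule eq_imp_le)
    next
      case False
      obtain v where v: "Q s t ` {..<n} = {..<v}" using Q_image_initial[OF assms] by blast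
      then have "q = v" using Q_mex[OF False] True by (simp add: mex_lessThan)
      then have "{j. j < n \<and> Q s t j = q} = {}" using v by auto
      then show ?thesis by (metis card.empty zero_le)
    qed
    then show ?thesis using True by (simp add: split)
  next
    case False
    then show ?thesis using Suc by (simp add: split)
  qed
qed

lemma finite_Q_fibre:
  assumes "s > 0"
  shows "finite {k. Q s t k = q}"
proof (rule ccontr)
  assume "infinite {k. Q s t k = q}"
  then obtain T where T: "T \<subseteq> {k. Q s t k = q}" "finite T" "card T = 3"
    using infinite_arbitrarily_large by blast
  then obtain n where "\<forall>k\<in>T. k < n" using finite_nat_set_iff_bounded by blast
  then have "T \<subseteq> {j. j < n \<and> Q s t j = q}" using T by auto
  then have "card T \<le> 2"
    using card_mono[of "{j. j < n \<and> Q s t j = q}" T] card_Q_fibre_le_2[OF assms, of n t q]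
    by simp
  then show False using T by simp
qed

lemma Q_attained:
  assumes "s > 0"
  shows "\<exists>k. Q s t k = q"
proof (rule ccontr)
  assume no: "\<not> ?thesis"
  have "Q s t k < q" for k
  proof -
    obtain v where v: "Q s t ` {..<Suc k} = {..<v}" using Q_image_initial[OF assms] by blast
    have "q \<notin> {..<v}" using no by (auto simp flip: v)
    moreover have "Q s t k \<in> {..<v}" by (simp flip: v)
    ultimately show ?thesis by simp
  qed
  then have "(UNIV :: nat set) \<subseteq> (\<Union>p\<in>{..<q}. {k. Q s t k = p})" by blast
  moreover have "finite (\<Union>p\<in>{..<q}. {k. Q s t k = p})"
    by (intro finite_UN_I finite_lessThan finite_Q_fibre[OF assms])
  ultimately have "finite (UNIV :: nat set)" by (rule finite_subset)
  then show False by simp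
qed

end

theory Submission
  imports Defs
begin

text \<open>For positive \<open>s\<close> and \<open>t\<close> the sequences \<open>A\<close> and \<open>B\<close> cover the natural numbers and meet
  only in \<open>A\<^sub>0 = B\<^sub>0 = 0\<close>. Hence strong induction on \<open>k\<close> shows that \<open>Q\<^sub>k = i\<close> exactly when
  \<open>k \<in> {A\<^sub>i, B\<^sub>i}\<close>: if \<open>k = B\<^sub>i\<close> with \<open>i > 0\<close>, then \<open>A\<^sub>i\<close> is the only earlier occurrence of
  \<open>i\<close> and \<open>k\<close> copies it; if \<open>k = A\<^sub>i\<close>, then a copied index would have to be some \<open>A\<^sub>q\<close> with
  \<open>A\<^sub>i = B\<^sub>q\<close>, which is impossible, while the earlier values of \<open>Q\<close> are those below \<open>i\<close>.\<close>

lemma mex_eqI: "\<lbrakk>k \<notin> S; \<And>j. j < k \<Longrightarrow> j \<in> S\<rbrakk> \<Longrightarrow> mex S = k"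
  unfolding mex_def by (rule Least_equality) (auto simp: not_less[symmetric])

lemma mex_notin: "finite S \<Longrightarrow> mex S \<notin> S"
  unfolding mex_def using ex_new_if_finite[of S] by (metis LeastI_ex infinite_UNIV_nat)

lemma less_mex_in: "k < mex S \<Longrightarrow> k \<in> S"
  unfolding mex_def using not_less_Least by blast

lemma A_notin_earlier: "A s t n \<notin> (\<Union>i<n. {A s t i, B s t i})"
  by (subst A.simps) (rule mex_notin, simp)

lemma less_A_in_earlier: "k < A s t n \<Longrightarrow> k \<in> (\<Union>i<n. {A s t i, B s t i})"
  by (subst (asm) A.simps) (rule less_mex_in)

text \<open>\<open>A s t j\<close> avoids the whole set whose mex is \<open>A s t i\<close>, so
  minimality gives \<open>A s t i \<le> A s t j\<close>; it also avoids \<open>A s t i\<close>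
  itself.\<close>

lemma strict_mono_A: "strict_mono (A s t)"
proof (rule strict_monoI)
  fix i j :: nat
  assume "i < j"
  then have "A s t j \<notin> (\<Union>l<i. {A s t l, B s t l})" "A s t j \<noteq> A s t i"
    using A_notin_earlier[of s t j] by auto
  then show "A s t i < A s t j"
    using less_A_in_earlier[of "A s t j" s t i] by fastforce
qed

lemma A_0: "A s t 0 = 0"
  using less_A_in_earlier[of 0 s t 0] by auto

lemma B_0: "B s t 0 = 0"
  by (simp add: B.simps A_0)

lemma A_less_B:
  assumes "s > 0" "t > 0" "i > 0"
  shows "A s t i < B s t i"
proof -
  have "A s t i \<le> s * A s t i" "0 < t * i"
    using assms by simp_all
  then show ?thesis unfolding B.simps by linarith
qed

lemma A_le_B:
  assumes "s > 0" "t > 0"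
  shows "A s t i \<le> B s t i"
  using A_less_B[OF assms, of i] by (cases "i = 0") (auto simp: A_0 B_0)

text \<open>If \<open>q < i\<close>, the mex defining \<open>A s t i\<close> excludes
  \<open>B s t q\<close>; otherwise \<open>A s t i \<le> A s t q < B s t q\<close>.\<close>

lemma A_neq_B:
  assumes "s > 0" "t > 0" "q > 0"
  shows "A s t i \<noteq> B s t q"
proof (cases "q < i")
  case True
  then show ?thesis using A_notin_earlier[of s t i] by auto
next
  case False
  then have "A s t i \<le> A s t q"
    using strict_mono_less_eq[OF strict_mono_A] by simp
  then show ?thesis using A_less_B[OF assms] by simp
qed

text \<open>Strict monotonicity gives \<open>k < A s t (Suc k)\<close>, and all numbers below a mex
  lie in its set.\<close>

lemma A_B_cover: "\<exists>i. k = A s t i \<or> k = B s t i"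
proof -
  have "Suc k \<le> A s t (Suc k)"
    by (rule strict_mono_imp_increasing[OF strict_mono_A])
  then show ?thesis using less_A_in_earlier[of k s t "Suc k"] by auto
qed

lemma strict_mono_B:
  assumes "t > 0"
  shows "strict_mono (B s t)"
proof (rule strict_monoI)
  fix i j :: nat
  assume "i < j"
  then have "A s t i \<le> A s t j"
    using strict_monoD[OF strict_mono_A, of i j s t] by simp
  then show "B s t i < B s t j"
    using \<open>i < j\<close> assms by (simp add: B.simps add_le_less_mono)
qed

lemma A_B_disjoint:
  assumes "s > 0" "t > 0" "k \<in> {A s t i, B s t i}" "k \<in> {A s t j, B s t j}"
  shows "i = j"
proof -
  have AB: "l = m" if "A s t l = B s t m" for l m
  proof (cases "m = 0")
    case True
    then have "A s t l = A s t m" using that by (simp add: A_0 B_0)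
    then show ?thesis using strict_mono_eq[OF strict_mono_A] by blast
  next
    case False
    then show ?thesis using A_neq_B[OF assms(1,2), of m l] that by simp
  qed
  show ?thesis
    using assms(3,4) AB[of i j] AB[of j i] strict_mono_eq[OF strict_mono_A, of s t i j]
      strict_mono_eq[OF strict_mono_B[OF assms(2)], of s i j] by auto
qed

lemma Q_eq_iff:
  assumes "s > 0" "t > 0"
  shows "Q s t k = i \<longleftrightarrow> k \<in> {A s t i, B s t i}"
proof (induction k arbitrary: i rule: less_induct)
  case (less k)
  \<comment> \<open>One such index suffices: by \<open>A_B_disjoint\<close> no other index has
    \<open>k\<close> in its pair.\<close>
  have "\<exists>i. k \<in> {A s t i, B s t i} \<and> Q s t k = i"
  proof (cases "\<exists>i>0. k = B s t i")
    case True
    then obtain i where i: "i > 0" "k = B s t i" by blast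
    have lt: "A s t i < k" using A_less_B[OF assms i(1)] i(2) by simp
    then have QA: "Q s t (A s t i) = i" using less.IH by simp
    have "j = A s t i" if "j < k" "Q s t j = i" for j
      using less.IH[OF that(1), of i] that i(2) by simp
    then have "{j. j < k \<and> Q s t j = i} = {A s t i}"
      using lt QA by blast
    then have "copies s t k (A s t i)"
      using lt QA i(2) by (simp add: copies_def B.simps)
    then have "Q s t k = i" using Q_copy[OF assms(1)] QA by simp
    then show ?thesis using i(2) by blast
  next
    case False
    \<comment> \<open>If the cover only yields \<open>k = B s t 0\<close>, then
      \<open>k = 0 = A s t 0\<close>.\<close>
    then obtain i where i: "k = A s t i"
      using A_B_cover[of k s t] by (metis A_0 B_0 gr0I)
    have "\<not> copies s t k m" for m
    proof
      assume m: "copies s t k m"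
      define q where "q = Q s t m"
      have mk: "m < k" "k = t * q + s * m" using m by (auto simp: copies_def q_def)
      have mq: "m \<in> {A s t q, B s t q}" using less.IH[OF mk(1)] q_def by blast
      have "m = A s t q"
      proof (rule ccontr)
        assume "m \<noteq> A s t q"
        \<comment> \<open>Now \<open>m = B s t q\<close>, so \<open>A s t q\<close> is an earlier
          occurrence of \<open>q\<close>, whereas a copied index is the first one.\<close>
        then have "A s t q < m" using mq A_le_B[OF assms, of q] by auto
        moreover from this have "Q s t (A s t q) = q" using less.IH mk(1) by simp
        ultimately show False using copies_firstD[OF m] q_def by blast
      qed
      then have "k = B s t q" using mk(2) by (simp add: B.simps)
      moreover have "q > 0"
        using mk(1) \<open>m = A s t q\<close> \<open>k = B s t q\<close> by (cases "q = 0") (auto simp: A_0 B_0)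
      ultimately show False using False by blast
    qed
    then have "Q s t k = mex (Q s t ` {..<k})" using Q_mex by blast
    also have "\<dots> = i"
    proof (rule mex_eqI)
      \<comment> \<open>Neither \<open>A s t i = k\<close> nor \<open>B s t i \<ge> k\<close> lies
        before \<open>k\<close>.\<close>
      have "Q s t m \<noteq> i" if "m < k" for m
        using less.IH[OF that, of i] that i A_le_B[OF assms, of i]
        by (metis insertE not_less singletonD order_refl)
      then show "i \<notin> Q s t ` {..<k}" by blast
      fix j assume "j < i"
      then have "A s t j < k" using strict_monoD[OF strict_mono_A] i by blast
      moreover from this have "Q s t (A s t j) = j" using less.IH by simp
      ultimately show "j \<in> Q s t ` {..<k}" by force
    qed
    finally show ?thesis using i by blast
  qed
  then obtain j where j: "k \<in> {A s t j, B s t j}" "Q s t k = j" by blast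
  then show ?case using A_B_disjoint[OF assms j(1), of i] by metis
qed

theorem theorem4:
  fixes s t :: nat
  assumes "s > 0" and "t > 0"
  shows "\<forall>n>0. A' s t n = A s t n \<and> B' s t n = B s t n"
proof (intro allI impI conjI)
  fix n :: nat
  show "A' s t n = A s t n"
    unfolding A'_def Q_eq_iff[OF assms]
    by (rule Least_equality) (use A_le_B[OF assms, of n] in auto)
  show "B' s t n = B s t n"
    unfolding B'_def Q_eq_iff[OF assms]
    by (rule Greatest_equality) (use A_le_B[OF assms, of n] in auto)
qed

end
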